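(* Let $(C,D)$ be a Top couple, let $H$ be an object of $C$, and let $I$, $J$ be normal subgroups of $H$. Then $$V([I,J]) = V(I)\cup V(J).$$ Moreover, let $(I_a)_{a\in A}$ be a family of normal subgroups of $H$ and let $I_A$ be the normal subgroup of $H$ generated by $(I_a)_{a\in A}$. Then $$V(I_A)=\bigcap_{a\in A}V(I_a).$$
   Context: For elements $a,b$ of a group, $[a,b]=aba^{-1}b^{-1}$; for subgroups $U,V$ of a group $H$, $[U,V]$ is the normal subgroup of $H$ generated by all $[u,v]$, $u\in U$, $v\in V$; $1$ also denotes the trivial subgroup. Let $C$ be a subcategory of the category of groups and $D$ a subclass of the class of objects of $C$. An ideal of an object $H$ of $C$ is a normal subgroup $I$ of $H$ such that $H/I$ is an object of $C$ and the projection $H\to H/I$ is a morphism of $C$. A prime ideal of $H$ is an ideal $P$ of $H$ with $P\neq H$ and $H/P\in D$. The pair $(C,D)$ is called a Top couple if: (T1) if $L$ is an object of $C$, $L'\in D$, and there is an injective $C$-morphism $L\to L'$, then $L\in D$; (T2) if $L\in D$ and $I,J$ are normal subgroups of $L$ with $[I,J]=1$, then $I=1$ or $J=1$; (T3) the inverse image of an ideal by a morphism of $C$ is an ideal. For a normal subgroup $I$ of an object $H$ of $C$, $V(I)$ denotes the set of prime ideals of $H$ which contain $I$. *)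

theory Defs
  imports "HOL-Algebra.Weak_Morphisms" "HOL-Library.FuncSet"
begin

text \<open>
  All groups of a category live in one universe type \<open>'u\<close>. Morphisms are extensional on the
  carrier of their domain, so that equality of morphisms is equality of set-theoretic maps.
\<close>

record 'u group_cat =
  Obj :: "'u monoid set"
  Mor :: "'u monoid \<Rightarrow> 'u monoid \<Rightarrow> ('u \<Rightarrow> 'u) set"

locale grp_subcategory =
  fixes C :: "'u group_cat"
  assumes Obj_group: "X \<in> Obj C \<Longrightarrow> group X"
    and Mor_hom: "\<lbrakk>X \<in> Obj C; Y \<in> Obj C\<rbrakk> \<Longrightarrow> Mor C X Y \<subseteq> hom X Y \<inter> extensional (carrier X)"
    and Mor_id: "X \<in> Obj C \<Longrightarrow> (\<lambda>x\<in>carrier X. x) \<in> Mor C X X"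
    and Mor_comp: "\<lbrakk>X \<in> Obj C; Y \<in> Obj C; Z \<in> Obj C; f \<in> Mor C X Y; g \<in> Mor C Y Z\<rbrakk>
           \<Longrightarrow> compose (carrier X) g f \<in> Mor C X Z"

text \<open>
  The library quotient \<open>H Mod I\<close> has type \<open>'u set monoid\<close>, whereas \<open>H/I\<close> has to be compared with
  the objects of \<open>C\<close>, which have type \<open>'u monoid\<close>. A coding \<open>q\<close> names each coset by an element of the
  universe, and \<open>H/I\<close> is the literal coset group with its elements renamed by \<open>q\<close>. In a
  set-theoretic universe, \<open>q\<close> is the identity on the cosets. In every type a coding exists, see
  \<open>coset_coding_choice\<close> below.
\<close>

definition coset_coding :: "('u set \<Rightarrow> 'u) \<Rightarrow> 'u monoid set \<Rightarrow> bool" where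
  "coset_coding q Ob \<longleftrightarrow> (\<forall>H\<in>Ob. \<forall>I. I \<lhd> H \<longrightarrow> inj_on q (carrier (H Mod I)))"

definition quotient_grp :: "('u set \<Rightarrow> 'u) \<Rightarrow> 'u monoid \<Rightarrow> 'u set \<Rightarrow> 'u monoid" where
  "quotient_grp q H I = image_group q (H Mod I)"

definition quotient_proj :: "('u set \<Rightarrow> 'u) \<Rightarrow> 'u monoid \<Rightarrow> 'u set \<Rightarrow> 'u \<Rightarrow> 'u" where
  "quotient_proj q H I = (\<lambda>x\<in>carrier H. q (I #>\<^bsub>H\<^esub> x))"

definition normal_closure :: "'u monoid \<Rightarrow> 'u set \<Rightarrow> 'u set" where
  "normal_closure G S = \<Inter>{N. N \<lhd> G \<and> S \<subseteq> N}"

definition comm_subgroup :: "'u monoid \<Rightarrow> 'u set \<Rightarrow> 'u set \<Rightarrow> 'u set" where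
  "comm_subgroup G U W = normal_closure G
     {u \<otimes>\<^bsub>G\<^esub> w \<otimes>\<^bsub>G\<^esub> inv\<^bsub>G\<^esub> u \<otimes>\<^bsub>G\<^esub> inv\<^bsub>G\<^esub> w | u w. u \<in> U \<and> w \<in> W}"

definition cat_ideal :: "('u set \<Rightarrow> 'u) \<Rightarrow> 'u group_cat \<Rightarrow> 'u monoid \<Rightarrow> 'u set \<Rightarrow> bool" where
  "cat_ideal q C H I \<longleftrightarrow> I \<lhd> H \<and> quotient_grp q H I \<in> Obj C
     \<and> quotient_proj q H I \<in> Mor C H (quotient_grp q H I)"

definition prime_ideals ::
    "('u set \<Rightarrow> 'u) \<Rightarrow> 'u group_cat \<Rightarrow> 'u monoid set \<Rightarrow> 'u monoid \<Rightarrow> 'u set set" where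
  "prime_ideals q C D H = {P. cat_ideal q C H P \<and> P \<noteq> carrier H \<and> quotient_grp q H P \<in> D}"

definition V ::
    "('u set \<Rightarrow> 'u) \<Rightarrow> 'u group_cat \<Rightarrow> 'u monoid set \<Rightarrow> 'u monoid \<Rightarrow> 'u set \<Rightarrow> 'u set set" where
  "V q C D H I = {P \<in> prime_ideals q C D H. I \<subseteq> P}"

locale top_couple = grp_subcategory C
  for q :: "'u set \<Rightarrow> 'u" and C :: "'u group_cat" and D :: "'u monoid set" +
  assumes coding: "coset_coding q (Obj C)"
    and D_subset: "D \<subseteq> Obj C"
    and T1: "\<lbrakk>L \<in> Obj C; L' \<in> D; f \<in> Mor C L L'; inj_on f (carrier L)\<rbrakk> \<Longrightarrow> L \<in> D"
    and T2: "\<lbrakk>L \<in> D; I \<lhd> L; J \<lhd> L; comm_subgroup L I J = {\<one>\<^bsub>L\<^esub>}\<rbrakk>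
           \<Longrightarrow> I = {\<one>\<^bsub>L\<^esub>} \<or> J = {\<one>\<^bsub>L\<^esub>}"
    and T3: "\<lbrakk>X \<in> Obj C; Y \<in> Obj C; f \<in> Mor C X Y; cat_ideal q C Y K\<rbrakk>
           \<Longrightarrow> cat_ideal q C X {x \<in> carrier X. f x \<in> K}"

lemma coset_coding_choice:
  assumes "\<And>H. H \<in> Ob \<Longrightarrow> group H"
  shows "coset_coding (\<lambda>X. SOME x. x \<in> X) Ob"
  unfolding coset_coding_def
proof (intro ballI allI impI inj_onI)
  fix H I X Y
  assume H: "H \<in> Ob" and I: "I \<lhd> H"
    and X: "X \<in> carrier (H Mod I)" and Y: "Y \<in> carrier (H Mod I)"
    and eq: "(SOME x. x \<in> X) = (SOME x. x \<in> Y)"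
  interpret group H using assms H .
  have sub: "subgroup I H" using I by (rule normal_imp_subgroup)
  have ne: "Z \<noteq> {}" if "Z \<in> carrier (H Mod I)" for Z
    using that rcos_self[OF _ sub] by (auto simp: carrier_FactGroup)
  have "(SOME x. x \<in> X) \<in> X" "(SOME x. x \<in> Y) \<in> Y"
    using ne[OF X] ne[OF Y] by (auto intro: some_in_eq[THEN iffD2])
  then have "\<not> disjnt X Y" using eq by (auto simp: disjnt_def)
  then show "X = Y"
    using rcos_disjoint[OF sub] X Y by (auto simp: FactGroup_def pairwise_def)
qed

lemma quotient_grp_iso:
  assumes "group H" "I \<lhd> H" "inj_on q (carrier (H Mod I))"
  shows "q \<in> iso (H Mod I) (quotient_grp q H I)"
proof -
  interpret Q: group "H Mod I" using assms(2) by (rule normal.factorgroup_is_group)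
  show ?thesis
    using assms(3)
    by (auto simp: iso_def hom_def quotient_grp_def image_group_def bij_betw_def
        simp del: mult_FactGroup)
qed

end

(* If P is prime and [I,J] is contained in P, then the images of I and J in H/P are normal, since
   the projection is surjective, and commute elementwise; so (T2) makes one of them trivial, which
   puts I or J into the kernel P. *)

theory Submission
  imports Defs
begin

lemma normal_closure_subset_iff:
  assumes "N \<lhd> G"
  shows "normal_closure G S \<subseteq> N \<longleftrightarrow> S \<subseteq> N"
  using assms unfolding normal_closure_def by blast

text \<open>A commutator is both \<open>u\<close> times a conjugate of its inverse and a conjugate
  of \<open>w\<close> times the inverse of \<open>w\<close>. A normal \<open>N\<close> containing
  either entry thus contains every generator, hence their normal closure.\<close>

lemma comm_subgroup_subset_normal:
  assumes "N \<lhd> G" and "U \<subseteq> carrier G" and "W \<subseteq> carrier G" and "U \<subseteq> N \<or> W \<subseteq> N"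
  shows "comm_subgroup G U W \<subseteq> N"
proof -
  interpret normal N G by fact
  have "u \<otimes>\<^bsub>G\<^esub> w \<otimes>\<^bsub>G\<^esub> inv\<^bsub>G\<^esub> u \<otimes>\<^bsub>G\<^esub> inv\<^bsub>G\<^esub> w \<in> N" if "u \<in> U" "w \<in> W" for u w
  proof -
    have u: "u \<in> carrier G" and w: "w \<in> carrier G" using that assms(2,3) by auto
    from assms(4) show ?thesis
    proof
      assume "U \<subseteq> N"
      then have uN: "u \<in> N" using that by auto
      have "u \<otimes>\<^bsub>G\<^esub> (w \<otimes>\<^bsub>G\<^esub> inv\<^bsub>G\<^esub> u \<otimes>\<^bsub>G\<^esub> inv\<^bsub>G\<^esub> w) \<in> N"
        using uN w by (simp add: inv_op_closed2)
      then show ?thesis using u w by (simp add: m_assoc)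
    next
      assume "W \<subseteq> N"
      then have wN: "w \<in> N" using that by auto
      show ?thesis using u wN by (simp add: inv_op_closed2)
    qed
  qed
  then show ?thesis
    using assms(1) unfolding comm_subgroup_def normal_closure_def by blast
qed

text \<open>A homomorphism carries commutators to commutators, so every generator of the commutator
  subgroup of the images is the identity. This supplies the commutator hypothesis of
  \<open>T2\<close> in a quotient.\<close>

lemma comm_subgroup_img_trivial:
  assumes "group_hom G H h" and "U \<subseteq> carrier G" and "W \<subseteq> carrier G"
    and "comm_subgroup G U W \<subseteq> kernel G H h"
  shows "comm_subgroup H (h ` U) (h ` W) = {\<one>\<^bsub>H\<^esub>}"
proof -
  interpret group_hom G H h by fact
  have triv: "h u \<otimes>\<^bsub>H\<^esub> h w \<otimes>\<^bsub>H\<^esub> inv\<^bsub>H\<^esub> h u \<otimes>\<^bsub>H\<^esub> inv\<^bsub>H\<^esub> h w = \<one>\<^bsub>H\<^esub>"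
    if "u \<in> U" "w \<in> W" for u w
  proof -
    have "u \<otimes>\<^bsub>G\<^esub> w \<otimes>\<^bsub>G\<^esub> inv\<^bsub>G\<^esub> u \<otimes>\<^bsub>G\<^esub> inv\<^bsub>G\<^esub> w \<in> kernel G H h"
      using assms(4) that unfolding comm_subgroup_def normal_closure_def by blast
    moreover have "u \<in> carrier G" "w \<in> carrier G" using that assms(2,3) by auto
    ultimately show ?thesis by (simp add: kernel_def)
  qed
  \<comment> \<open>The trivial subgroup is normal and contains all generators, so it is one of the
    sets intersected in the closure.\<close>
  have "comm_subgroup H (h ` U) (h ` W) \<subseteq> {\<one>\<^bsub>H\<^esub>}"
    unfolding comm_subgroup_def normal_closure_def
    using triv H.one_is_normal by fastforce
  moreover have "\<one>\<^bsub>H\<^esub> \<in> comm_subgroup H (h ` U) (h ` W)"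
    unfolding comm_subgroup_def normal_closure_def
    by (auto intro: subgroup.one_closed normal_imp_subgroup)
  ultimately show ?thesis by blast
qed

text \<open>The usual facts on the projection to the coset group survive the renaming of cosets:
  injectivity of \<open>q\<close> turns the renamed copy into an isomorphic group and keeps the
  kernel from growing.\<close>

lemma quotient_proj_group_hom:
  assumes "group G" "N \<lhd> G" "inj_on q (carrier (G Mod N))"
  shows "group_hom G (quotient_grp q G N) (quotient_proj q G N)"
    and "quotient_proj q G N ` carrier G = carrier (quotient_grp q G N)"
    and "kernel G (quotient_grp q G N) (quotient_proj q G N) = N"
proof -
  interpret normal N G by fact
  interpret Q: group "G Mod N" by (rule factorgroup_is_group)
  have q: "q \<in> iso (G Mod N) (quotient_grp q G N)" using assms by (rule quotient_grp_iso)
  interpret L: group "quotient_grp q G N"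
    unfolding quotient_grp_def using assms(3) by (rule Q.inj_imp_image_group_is_group)
  interpret q: group_hom "G Mod N" "quotient_grp q G N" q
    using q by unfold_locales (simp add: iso_def)
  \<comment> \<open>The projection is the coset map followed by the renaming isomorphism, hence a
    homomorphism.\<close>
  have "quotient_proj q G N = compose (carrier G) q (\<lambda>x. N #>\<^bsub>G\<^esub> x)"
    by (simp add: quotient_proj_def compose_def)
  then have "quotient_proj q G N \<in> hom G (quotient_grp q G N)"
    using hom_compose[OF r_coset_hom_Mod q.homh] by simp
  then show "group_hom G (quotient_grp q G N) (quotient_proj q G N)"
    by unfold_locales
  show "quotient_proj q G N ` carrier G = carrier (quotient_grp q G N)"
    by (auto simp: quotient_grp_def image_group_def quotient_proj_def carrier_FactGroup)
  \<comment> \<open>The identity of the renamed quotient is \<open>q N\<close>, because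
    \<open>N\<close> is the identity of \<open>G Mod N\<close>. Both cosets lie in the carrier, so
    \<open>q\<close> can be cancelled.\<close>
  have "q (N #>\<^bsub>G\<^esub> x) = \<one>\<^bsub>quotient_grp q G N\<^esub> \<longleftrightarrow> x \<in> N" if x: "x \<in> carrier G" for x
  proof -
    have "q (N #>\<^bsub>G\<^esub> x) = \<one>\<^bsub>quotient_grp q G N\<^esub> \<longleftrightarrow> q (N #>\<^bsub>G\<^esub> x) = q N"
      using q.hom_one by simp
    also have "\<dots> \<longleftrightarrow> N #>\<^bsub>G\<^esub> x = N"
      using x Q.one_closed by (intro inj_on_eq_iff[OF assms(3)]) (auto simp: carrier_FactGroup)
    also have "\<dots> \<longleftrightarrow> x \<in> N"
      using x coset_join1[OF _ x subgroup_axioms] coset_join2[OF x subgroup_axioms]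
      by (auto simp: subset)
    finally show ?thesis .
  qed
  then show "kernel G (quotient_grp q G N) (quotient_proj q G N) = N"
    using subset by (auto simp: kernel_def quotient_proj_def)
qed

context top_couple
begin

text \<open>This is the analogue of primeness in rings, with commutators in place of products; the
  union formula is this equivalence read at each prime ideal.\<close>

lemma comm_subgroup_subset_prime_iff:
  assumes H: "H \<in> Obj C" and P: "P \<in> prime_ideals q C D H" and I: "I \<lhd> H" and J: "J \<lhd> H"
  shows "comm_subgroup H I J \<subseteq> P \<longleftrightarrow> I \<subseteq> P \<or> J \<subseteq> P"
proof
  let ?L = "quotient_grp q H P" and ?p = "quotient_proj q H P"
  have PH: "P \<lhd> H" and L: "?L \<in> D" using P by (auto simp: prime_ideals_def cat_ideal_def)
  have sub: "I \<subseteq> carrier H" "J \<subseteq> carrier H"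
    using I J by (auto dest: normal_imp_subgroup subgroup.subset)
  show "comm_subgroup H I J \<subseteq> P" if "I \<subseteq> P \<or> J \<subseteq> P"
    using comm_subgroup_subset_normal[OF PH sub that] .
  have inj: "inj_on q (carrier (H Mod P))"
    using coding H PH by (auto simp: coset_coding_def)
  note pr = quotient_proj_group_hom[OF Obj_group[OF H] PH inj]
  assume "comm_subgroup H I J \<subseteq> P"
  \<comment> \<open>The kernel of \<open>?p\<close> is exactly \<open>P\<close>, so the assumption
    says that the commutators of \<open>I\<close> and \<open>J\<close> vanish in
    \<open>?L\<close>.\<close>
  then have "comm_subgroup ?L (?p ` I) (?p ` J) = {\<one>\<^bsub>?L\<^esub>}"
    by (intro comm_subgroup_img_trivial[OF pr(1) sub]) (simp only: pr(3))
  then have "?p ` I = {\<one>\<^bsub>?L\<^esub>} \<or> ?p ` J = {\<one>\<^bsub>?L\<^esub>}"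
    by (rule T2[OF L normal.surj_hom_normal_subgroup[OF I pr(1,2)]
          normal.surj_hom_normal_subgroup[OF J pr(1,2)]])
  then have "I \<subseteq> kernel H ?L ?p \<or> J \<subseteq> kernel H ?L ?p"
    using sub unfolding kernel_def by blast
  then show "I \<subseteq> P \<or> J \<subseteq> P" by (simp only: pr(3))
qed

end

theorem proposition3p1:
  fixes q :: "'u set \<Rightarrow> 'u" and C :: "'u group_cat" and D :: "'u monoid set" and H :: "'u monoid"
  assumes "top_couple q C D" and "H \<in> Obj C"
  shows "(\<forall>I J. I \<lhd> H \<and> J \<lhd> H \<longrightarrow>
            V q C D H (comm_subgroup H I J) = V q C D H I \<union> V q C D H J)
       \<and> (\<forall>(A :: 'i set) F. (\<forall>a\<in>A. F a \<lhd> H) \<longrightarrow>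
            V q C D H (normal_closure H (\<Union>a\<in>A. F a))
              = prime_ideals q C D H \<inter> (\<Inter>a\<in>A. V q C D H (F a)))"
proof (intro conjI allI impI)
  interpret top_couple q C D by fact
  show "V q C D H (comm_subgroup H I J) = V q C D H I \<union> V q C D H J" if "I \<lhd> H \<and> J \<lhd> H" for I J
    using comm_subgroup_subset_prime_iff[OF assms(2)] that unfolding V_def by blast
  fix A :: "'i set" and F
  \<comment> \<open>A prime ideal is normal, so it contains the closure as soon as it contains the
    union of the family.\<close>
  have "normal_closure H (\<Union>a\<in>A. F a) \<subseteq> P \<longleftrightarrow> (\<forall>a\<in>A. F a \<subseteq> P)"
    if "P \<in> prime_ideals q C D H" for P
  proof -
    have "P \<lhd> H" using that by (simp add: prime_ideals_def cat_ideal_def)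
    then show ?thesis by (simp add: normal_closure_subset_iff UN_subset_iff)
  qed
  \<comment> \<open>For empty \<open>A\<close> the inner intersection is the whole type; the factor
    \<open>prime_ideals q C D H\<close> then gives all prime ideals, as it should for the trivial
    subgroup.\<close>
  then show "V q C D H (normal_closure H (\<Union>a\<in>A. F a))
      = prime_ideals q C D H \<inter> (\<Inter>a\<in>A. V q C D H (F a))"
    by (auto simp: V_def)
qed

end
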